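(* Let $p,q,r>1$ be real numbers satisfying $\frac1p+\frac1q+\frac1r=2$. Then for all $f\in L_p(\mathbb{R})$, $g\in L_q(\mathbb{R})$ and $h\in L_r(\mathbb{R})$, $$\left|\int_{\mathbb{R}} \big(f \underset{H}{*} g\big)(x)\, h(x)\, dx\right|\leq \sqrt{\frac{2}{\pi}}\,\|f\|_{L_p(\mathbb{R})} \|g\|_{L_q(\mathbb{R})} \|h\|_{L_r(\mathbb{R})}.$$
   Context: The Hartley convolution of $f$ and $g$ (given by the same formula for both Hartley transforms $H_1$ and $H_2$, and written here $\underset{H}{*}$) is $$\big(f\underset{H}{*} g\big)(x):= \frac{1}{2\sqrt{2\pi}}\int_{\mathbb{R}} f(y)\,[g(x+y) + g(x-y) + g(-x+y) - g(-x-y)]\, dy,\quad x\in\mathbb{R}.$$ $L_p(\mathbb{R})$ denotes the usual Lebesgue space with $\|f\|_{L_p(\mathbb{R})}=\big(\int_{\mathbb{R}}|f(x)|^p dx\big)^{1/p}$. *)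

theory Defs
  imports "HOL-Analysis.Analysis"
begin

text \<open>
  The scalar type \<open>'a\<close> is a real normed field, so that real-valued and complex-valued functions
  are both covered. Elements of \<open>L\<^sub>p(\<real>)\<close> are represented by functions rather than by
  almost-everywhere classes.
\<close>

definition Lp_space ::
  "real \<Rightarrow> (real \<Rightarrow> 'a::{real_normed_field, banach, second_countable_topology}) set" where
  "Lp_space p =
     {f \<in> borel_measurable lebesgue. integrable lebesgue (\<lambda>x. norm (f x) powr p)}"

definition Lp_norm ::
  "real \<Rightarrow> (real \<Rightarrow> 'a::{real_normed_field, banach, second_countable_topology}) \<Rightarrow> real" where
  "Lp_norm p f = (LINT x|lebesgue. norm (f x) powr p) powr (1 / p)"

definition hartley_integrand ::
  "(real \<Rightarrow> 'a::{real_normed_field, banach, second_countable_topology}) \<Rightarrow> (real \<Rightarrow> 'a) \<Rightarrow>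
     real \<Rightarrow> real \<Rightarrow> 'a" where
  "hartley_integrand f g x y = f y * (g (x + y) + g (x - y) + g (- x + y) - g (- x - y))"

text \<open>
  At points \<open>x\<close> where the integrand is not integrable, the library integral is \<open>0\<close> by convention.
\<close>

definition hartley_conv ::
  "(real \<Rightarrow> 'a::{real_normed_field, banach, second_countable_topology}) \<Rightarrow> (real \<Rightarrow> 'a) \<Rightarrow>
     real \<Rightarrow> 'a" where
  "hartley_conv f g x =
     (1 / (2 * sqrt (2 * pi))) *\<^sub>R (LINT y|lebesgue. hartley_integrand f g x y)"

end

theory Submission
  imports Defs
begin

text \<open>
  The constant comes from counting: the Hartley convolution has prefactor \<open>1 / (2 * sqrt (2 * pi))\<close>
  and a kernel with four terms, and \<open>4 / (2 * sqrt (2 * pi)) = sqrt (2 / pi)\<close>. Each term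
  contributes at most the product of the three norms, by Young's convolution inequality in its
  symmetric trilinear form (lemma \<open>young_trilinear\<close>)
  for the double integral of \<open>norm (f y) * norm (g (s * x + t * y)) * norm (h x)\<close> with signs
  \<open>s\<close> and \<open>t\<close>.

  For that inequality, normalize the three norms to at most \<open>1\<close>. The numbers \<open>1 - 1/r\<close>, \<open>1 - 1/q\<close>
  and \<open>1 - 1/p\<close> are positive and sum to \<open>1\<close>, and the product \<open>F G H\<close> is the geometric mean, with
  these weights, of \<open>F\<^sup>p G\<^sup>q\<close>, \<open>F\<^sup>p H\<^sup>r\<close> and \<open>G\<^sup>q H\<^sup>r\<close>. It is therefore at most the corresponding
  arithmetic mean (\<open>young_pointwise\<close>). In each of these three products one of the variables can be
  integrated out first, and by invariance of Lebesgue measure under translations and reflections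
  the double integral is a product of two single integrals, hence at most \<open>1\<close>.

  This argument needs Tonelli's theorem, and for Lebesgue measurable \<open>g\<close> the map
  \<open>(x, y) \<mapsto> g (s * x + t * y)\<close> need not be measurable for the product \<open>\<sigma>\<close>-algebra
  of two copies of the Lebesgue sets. The estimates are therefore proved for Borel functions, and
  \<open>f\<close>, \<open>g\<close>, \<open>h\<close> are replaced by Borel functions that agree with them almost everywhere. The
  replacement does not change \<open>hartley_conv f g\<close> at any point, because a null set stays null under
  \<open>y \<mapsto> t + c * y\<close> for \<open>c \<noteq> 0\<close>.
\<close>

section \<open>Borel representatives\<close>

text \<open>
  A simple function of the completion agrees almost everywhere with a simple function of the
  original space; countably many such changes are made along a sequence of simple functions that
  converges pointwise to \<open>g\<close>. The new sequence may diverge on a null set, but its \<open>lim\<close> is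
  measurable whatever value it takes there.
\<close>

lemma completion_ex_borel_measurable_banach:
  fixes g :: "'a \<Rightarrow> 'b::{banach, second_countable_topology}"
  assumes g: "g \<in> borel_measurable (completion M)"
  shows "\<exists>g'\<in>borel_measurable M. AE x in M. g x = g' x"
proof -
  obtain s where s: "\<And>i. simple_function (completion M) (s i)"
      and lim: "\<And>x. x \<in> space M \<Longrightarrow> (\<lambda>i. s i x) \<longlonglongrightarrow> g x"
    using borel_measurable_implies_sequence_metric[OF g] by (metis space_completion)
  have "\<forall>i. \<exists>s'. simple_function M s' \<and> (AE x in M. s i x = s' x)"
    using s completion_ex_simple_function by blast
  then obtain s' where s': "\<And>i. simple_function M (s' i)"
      and eq: "\<And>i. AE x in M. s i x = s' i x"
    by metis
  have [measurable]: "s' i \<in> borel_measurable M" for i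
    using s' by (rule borel_measurable_simple_function)
  show ?thesis
  proof (rule bexI)
    have "AE x in M. \<forall>i. s i x = s' i x"
      using eq by (simp add: AE_all_countable)
    then show "AE x in M. g x = lim (\<lambda>i. s' i x)"
      using AE_space
    proof eventually_elim
      case (elim x)
      then have "(\<lambda>i. s' i x) \<longlonglongrightarrow> g x"
        using lim[of x] by simp
      then show ?case
        by (simp add: limI)
    qed
  qed measurable
qed

text \<open>
  The exceptional set of \<open>P\<close> need not be Borel, so the library fact for measurable predicates is
  applied to the complement of a Borel null set that covers it.
\<close>

lemma AE_lborel_affine:
  fixes P :: "real \<Rightarrow> bool"
  assumes "c \<noteq> 0" and "AE x in lborel. P x"
  shows "AE x in lborel. P (t + c * x)"
proof -
  obtain N where N: "N \<in> null_sets lborel" and P: "{x. \<not> P x} \<subseteq> N"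
    using assms(2) unfolding eventually_ae_filter by auto
  have [measurable]: "N \<in> sets borel"
    using N by auto
  have "AE x in lborel. x \<notin> N"
    using N by (rule AE_not_in)
  then have "AE x in lborel. t + c * x \<notin> N"
    by (intro AE_borel_affine assms(1)) auto
  then show ?thesis
    using P by (auto elim!: eventually_mono)
qed

lemma borel_measurable_lebesgue_affine:
  fixes g :: "real \<Rightarrow> 'a::topological_space"
  assumes "g \<in> borel_measurable lebesgue" and "c \<noteq> 0"
  shows "(\<lambda>x. g (t + c * x)) \<in> borel_measurable lebesgue"
proof -
  have "(\<lambda>x. t + c * x) \<in> lebesgue \<rightarrow>\<^sub>M lebesgue"
    using lebesgue_affine_measurable[of "\<lambda>_. c" t] assms(2) by simp
  then show ?thesis
    using assms(1) by (rule measurable_compose)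
qed

section \<open>Young's convolution inequality in trilinear form\<close>

text \<open>
  This is the inequality between the weighted arithmetic and geometric means of three numbers. The
  condition on the exponents says both that the weights sum to \<open>1\<close> and that each of \<open>x\<close>, \<open>y\<close>, \<open>z\<close>
  occurs in the geometric mean with exponent \<open>1\<close>; for example \<open>p * ((1 - 1/r) + (1 - 1/q)) = 1\<close>.
\<close>

lemma young_pointwise:
  fixes p q r x y z :: real
  assumes "p > 1" "q > 1" "r > 1" and sum: "1 / p + 1 / q + 1 / r = 2"
    and "x \<ge> 0" "y \<ge> 0" "z \<ge> 0"
  shows "x * y * z \<le> (1 - 1 / r) * (x powr p * y powr q)
      + (1 - 1 / q) * (x powr p * z powr r) + (1 - 1 / p) * (y powr q * z powr r)"
proof (cases "x = 0 \<or> y = 0 \<or> z = 0")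
  case True
  have "0 \<le> 1 - 1 / r" "0 \<le> 1 - 1 / q" "0 \<le> 1 - 1 / p"
    using assms by simp_all
  then show ?thesis
    using True by (intro order_trans[OF _ add_nonneg_nonneg]) auto
next
  case False
  then have pos: "x > 0" "y > 0" "z > 0"
    using assms by auto
  define a b c where "a = 1 - 1 / r" and "b = 1 - 1 / q" and "c = 1 - 1 / p"
  define u v w where "u = x powr p * y powr q" and "v = x powr p * z powr r"
    and "w = y powr q * z powr r"
  have abc: "a > 0" "b > 0" "c > 0" "a + b + c = 1"
    using assms by (auto simp: a_def b_def c_def)
  have uvw: "u > 0" "v > 0" "w > 0"
    using pos by (auto simp: u_def v_def w_def)
  define m where "m = a * u + b * v + c * w"
  have m: "m > 0"
    using abc uvw by (auto simp: m_def intro!: add_pos_pos)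
  \<comment> \<open>Concavity of the logarithm is used through its tangent line at the arithmetic mean \<open>m\<close>.\<close>
  have tangent: "ln k - ln m \<le> k / m - 1" if "k > 0" for k
    using ln_le_minus_one[of "k / m"] that m by (simp add: ln_div)
  have "a * (ln u - ln m) + b * (ln v - ln m) + c * (ln w - ln m)
      \<le> a * (u / m - 1) + b * (v / m - 1) + c * (w / m - 1)"
    using abc uvw tangent by (intro add_mono mult_left_mono) auto
  also have "\<dots> = (a * u + b * v + c * w) / m - (a + b + c)"
    by (simp add: field_simps add_divide_distrib)
  also have "\<dots> = 0"
    using m abc(4) by (simp flip: m_def)
  finally have "a * ln u + b * ln v + c * ln w \<le> (a + b + c) * ln m"
    by (simp add: algebra_simps)
  moreover have "a * ln u + b * ln v + c * ln w = ln x + ln y + ln z"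
  proof -
    have *: "p * (a + b) = 1" "q * (a + c) = 1" "r * (b + c) = 1"
      using assms sum by (auto simp: a_def b_def c_def field_simps)
    have "ln u = p * ln x + q * ln y" "ln v = p * ln x + r * ln z" "ln w = q * ln y + r * ln z"
      using pos by (auto simp: u_def v_def w_def ln_mult ln_powr)
    then have "a * ln u + b * ln v + c * ln w
        = (p * (a + b)) * ln x + (q * (a + c)) * ln y + (r * (b + c)) * ln z"
      by (simp add: algebra_simps)
    then show ?thesis
      unfolding * by simp
  qed
  ultimately have "ln (x * y * z) \<le> ln m"
    using pos abc(4) by (simp add: ln_mult)
  then have "x * y * z \<le> m"
    using pos m by (simp add: ln_le_cancel_iff)
  then show ?thesis
    by (simp add: m_def a_def b_def c_def u_def v_def w_def)
qed

lemma nn_integral_lborel_affine_unit: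
  fixes f :: "real \<Rightarrow> ennreal"
  assumes "f \<in> borel_measurable borel" and "\<bar>c\<bar> = 1"
  shows "(\<integral>\<^sup>+x. f (c * x + t) \<partial>lborel) = (\<integral>\<^sup>+x. f x \<partial>lborel)"
    and "(\<integral>\<^sup>+x. f (t + c * x) \<partial>lborel) = (\<integral>\<^sup>+x. f x \<partial>lborel)"
proof -
  show "(\<integral>\<^sup>+x. f (t + c * x) \<partial>lborel) = (\<integral>\<^sup>+x. f x \<partial>lborel)"
    using nn_integral_real_affine[OF assms(1), of c t] assms(2) by auto
  then show "(\<integral>\<^sup>+x. f (c * x + t) \<partial>lborel) = (\<integral>\<^sup>+x. f x \<partial>lborel)"
    by (simp add: add.commute)
qed

text \<open>
  In each of the three products of the arithmetic mean, integrate first over a variable on which only one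
  factor depends: over \<open>x\<close> in \<open>F\<^sup>p G\<^sup>q\<close>, which requires an exchange of the integrals, and over \<open>y\<close> in
  the other two.
\<close>

lemma young_trilinear_normalized:
  fixes F G H :: "real \<Rightarrow> real" and p q r s t :: real
  assumes "p > 1" "q > 1" "r > 1" "1 / p + 1 / q + 1 / r = 2" and s: "\<bar>s\<bar> = 1" and t: "\<bar>t\<bar> = 1"
    and [measurable]: "F \<in> borel_measurable borel" "G \<in> borel_measurable borel"
      "H \<in> borel_measurable borel"
    and nonneg: "\<And>x. F x \<ge> 0" "\<And>x. G x \<ge> 0" "\<And>x. H x \<ge> 0"
    and F: "(\<integral>\<^sup>+x. ennreal (F x powr p) \<partial>lborel) \<le> 1"
    and G: "(\<integral>\<^sup>+x. ennreal (G x powr q) \<partial>lborel) \<le> 1"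
    and H: "(\<integral>\<^sup>+x. ennreal (H x powr r) \<partial>lborel) \<le> 1"
  shows "(\<integral>\<^sup>+x. \<integral>\<^sup>+y. ennreal (F y * G (s * x + t * y) * H x) \<partial>lborel \<partial>lborel) \<le> 1"
proof -
  define F' G' H' where "F' x = ennreal (F x powr p)" and "G' x = ennreal (G x powr q)"
    and "H' x = ennreal (H x powr r)" for x
  have [measurable]: "F' \<in> borel_measurable borel" "G' \<in> borel_measurable borel"
      "H' \<in> borel_measurable borel"
    unfolding F'_def G'_def H'_def by measurable
  define A B C where "A = (\<integral>\<^sup>+x. F' x \<partial>lborel)" and "B = (\<integral>\<^sup>+x. G' x \<partial>lborel)"
    and "C = (\<integral>\<^sup>+x. H' x \<partial>lborel)"
  have le1: "A \<le> 1" "B \<le> 1" "C \<le> 1"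
    using F G H by (auto simp: A_def B_def C_def F'_def G'_def H'_def)
  define a b c where "a = 1 - 1 / r" and "b = 1 - 1 / q" and "c = 1 - 1 / p"
  have abc: "a \<ge> 0" "b \<ge> 0" "c \<ge> 0" "a + b + c = 1"
    using assms(1-4) by (auto simp: a_def b_def c_def)
  have FG: "(\<integral>\<^sup>+x. \<integral>\<^sup>+y. F' y * G' (s * x + t * y) \<partial>lborel \<partial>lborel) = A * B"
  proof -
    have "(\<integral>\<^sup>+x. \<integral>\<^sup>+y. F' y * G' (s * x + t * y) \<partial>lborel \<partial>lborel)
        = (\<integral>\<^sup>+y. \<integral>\<^sup>+x. F' y * G' (s * x + t * y) \<partial>lborel \<partial>lborel)"
      by (rule lborel_pair.Fubini') measurable
    also have "\<dots> = (\<integral>\<^sup>+y. F' y * B \<partial>lborel)"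
      by (simp add: nn_integral_cmult nn_integral_lborel_affine_unit s B_def)
    also have "\<dots> = A * B"
      by (simp add: nn_integral_multc A_def)
    finally show ?thesis .
  qed
  have FH: "(\<integral>\<^sup>+x. \<integral>\<^sup>+y. F' y * H' x \<partial>lborel \<partial>lborel) = A * C"
    by (simp add: nn_integral_multc nn_integral_cmult A_def C_def)
  have GH: "(\<integral>\<^sup>+x. \<integral>\<^sup>+y. G' (s * x + t * y) * H' x \<partial>lborel \<partial>lborel) = B * C"
    by (simp add: nn_integral_multc nn_integral_cmult nn_integral_lborel_affine_unit t B_def C_def)
  have "(\<integral>\<^sup>+x. \<integral>\<^sup>+y. ennreal (F y * G (s * x + t * y) * H x) \<partial>lborel \<partial>lborel)
    \<le> (\<integral>\<^sup>+x. \<integral>\<^sup>+y. ennreal a * (F' y * G' (s * x + t * y)) + ennreal b * (F' y * H' x)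
        + ennreal c * (G' (s * x + t * y) * H' x) \<partial>lborel \<partial>lborel)"
  proof (intro nn_integral_mono)
    fix x y
    have "F y * G (s * x + t * y) * H x
      \<le> a * (F y powr p * G (s * x + t * y) powr q) + b * (F y powr p * H x powr r)
        + c * (G (s * x + t * y) powr q * H x powr r)"
      unfolding a_def b_def c_def by (intro young_pointwise assms)
    then show "ennreal (F y * G (s * x + t * y) * H x)
      \<le> ennreal a * (F' y * G' (s * x + t * y)) + ennreal b * (F' y * H' x)
        + ennreal c * (G' (s * x + t * y) * H' x)"
      using abc by (simp add: F'_def G'_def H'_def flip: ennreal_mult ennreal_plus)
  qed
  also have "\<dots> = ennreal a * (A * B) + ennreal b * (A * C) + ennreal c * (B * C)"
    by (simp add: nn_integral_add nn_integral_cmult flip: FG FH GH)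
  also have "\<dots> \<le> ennreal a * 1 + ennreal b * 1 + ennreal c * 1"
    using le1 by (intro add_mono mult_left_mono mult_le_one) auto
  also have "\<dots> = 1"
    using abc by (simp flip: ennreal_plus)
  finally show ?thesis .
qed

lemma Lp_norm_nonneg: "0 \<le> Lp_norm p f"
  by (simp add: Lp_norm_def)

text \<open>
  The summand \<open>e\<close> makes the divisor positive even when the norm is zero.
\<close>

lemma nn_integral_Lp_normalized_le_1:
  assumes "p > 1" and f: "f \<in> Lp_space p" and [measurable]: "f \<in> borel_measurable borel"
    and e: "e > 0"
  shows "(\<integral>\<^sup>+x. ennreal ((norm (f x) / (Lp_norm p f + e)) powr p) \<partial>lborel) \<le> 1"
proof -
  define I where "I = (\<integral>x. norm (f x) powr p \<partial>lborel)"
  have int: "integrable lborel (\<lambda>x. norm (f x) powr p)"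
    using f unfolding Lp_space_def by (simp add: integrable_completion)
  have I: "I \<ge> 0" "Lp_norm p f = I powr (1 / p)"
    by (simp_all add: I_def Lp_norm_def integral_completion)
  have pos: "Lp_norm p f + e > 0"
    using Lp_norm_nonneg[of p f] e by simp
  have "(\<integral>\<^sup>+x. ennreal ((norm (f x) / (Lp_norm p f + e)) powr p) \<partial>lborel)
      = (\<integral>\<^sup>+x. ennreal (norm (f x) powr p / (Lp_norm p f + e) powr p) \<partial>lborel)"
    using pos by (simp add: powr_divide)
  also have "\<dots> = ennreal (\<integral>x. norm (f x) powr p / (Lp_norm p f + e) powr p \<partial>lborel)"
    using int by (intro nn_integral_eq_integral) auto
  also have "\<dots> = ennreal (I / (Lp_norm p f + e) powr p)"
    by (simp add: I_def)
  also have "\<dots> \<le> 1"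
  proof -
    have "I = (Lp_norm p f) powr p"
      using I assms(1) by (simp add: powr_powr)
    also have "\<dots> \<le> (Lp_norm p f + e) powr p"
      using e assms(1) Lp_norm_nonneg by (intro powr_mono2) auto
    finally show ?thesis
      using pos by simp
  qed
  finally show ?thesis .
qed

text \<open>
  The three norms are enlarged by \<open>e > 0\<close> before normalizing, and then \<open>e\<close> tends to \<open>0\<close>. In this way
  functions of norm zero need no separate treatment.
\<close>

lemma young_trilinear:
  fixes f :: "real \<Rightarrow> 'a::{real_normed_field, banach, second_countable_topology}"
    and g :: "real \<Rightarrow> 'b::{real_normed_field, banach, second_countable_topology}"
    and h :: "real \<Rightarrow> 'c::{real_normed_field, banach, second_countable_topology}"
  assumes "p > 1" "q > 1" "r > 1" "1 / p + 1 / q + 1 / r = 2" and "\<bar>s\<bar> = 1" and "\<bar>t\<bar> = 1"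
    and [measurable]: "f \<in> borel_measurable borel" "g \<in> borel_measurable borel"
      "h \<in> borel_measurable borel"
    and "f \<in> Lp_space p" "g \<in> Lp_space q" "h \<in> Lp_space r"
  shows "(\<integral>\<^sup>+x. \<integral>\<^sup>+y. ennreal (norm (f y) * norm (g (s * x + t * y)) * norm (h x)) \<partial>lborel \<partial>lborel)
    \<le> ennreal (Lp_norm p f * Lp_norm q g * Lp_norm r h)" (is "?I \<le> _")
proof -
  have bound: "?I \<le> ennreal ((Lp_norm p f + e) * (Lp_norm q g + e) * (Lp_norm r h + e))"
    if e: "e > 0" for e
  proof -
    define A B C where "A = Lp_norm p f + e" and "B = Lp_norm q g + e" and "C = Lp_norm r h + e"
    have pos: "A > 0" "B > 0" "C > 0"
      using e Lp_norm_nonneg[of p f] Lp_norm_nonneg[of q g] Lp_norm_nonneg[of r h]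
      by (auto simp: A_def B_def C_def)
    have "?I = (\<integral>\<^sup>+x. \<integral>\<^sup>+y. ennreal (A * B * C) * ennreal (norm (f y) / A
        * (norm (g (s * x + t * y)) / B) * (norm (h x) / C)) \<partial>lborel \<partial>lborel)"
      using pos by (intro nn_integral_cong) (simp flip: ennreal_mult)
    also have "\<dots> = ennreal (A * B * C) * (\<integral>\<^sup>+x. \<integral>\<^sup>+y. ennreal (norm (f y) / A
        * (norm (g (s * x + t * y)) / B) * (norm (h x) / C)) \<partial>lborel \<partial>lborel)"
      by (simp add: nn_integral_cmult)
    also have "\<dots> \<le> ennreal (A * B * C) * 1"
    proof (intro mult_left_mono)
      show "(\<integral>\<^sup>+x. \<integral>\<^sup>+y. ennreal (norm (f y) / A
        * (norm (g (s * x + t * y)) / B) * (norm (h x) / C)) \<partial>lborel \<partial>lborel) \<le> 1"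
        by (rule young_trilinear_normalized[OF assms(1-6)])
           (use pos in \<open>simp_all add: A_def B_def C_def nn_integral_Lp_normalized_le_1 assms e\<close>)
    qed simp
    finally show ?thesis
      by (simp add: A_def B_def C_def)
  qed
  have "((\<lambda>e. ennreal ((Lp_norm p f + e) * (Lp_norm q g + e) * (Lp_norm r h + e)))
      \<longlongrightarrow> ennreal ((Lp_norm p f + 0) * (Lp_norm q g + 0) * (Lp_norm r h + 0))) (at_right 0)"
    by (intro tendsto_intros)
  then have "?I \<le> ennreal ((Lp_norm p f + 0) * (Lp_norm q g + 0) * (Lp_norm r h + 0))"
    by (rule tendsto_lowerbound)
       (use bound in \<open>auto intro!: eventually_mono[OF eventually_at_right_less]\<close>)
  then show ?thesis
    by simp
qed

section \<open>The Hartley convolution of Borel functions\<close>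

lemma hartley_integrand_measurable [measurable]:
  fixes f g :: "real \<Rightarrow> 'a::{real_normed_field, banach, second_countable_topology}"
  assumes [measurable]: "f \<in> borel_measurable borel" "g \<in> borel_measurable borel"
  shows "(\<lambda>(x, y). hartley_integrand f g x y) \<in> borel_measurable (borel \<Otimes>\<^sub>M borel)"
  unfolding hartley_integrand_def by measurable

lemma hartley_integrand_section_measurable [measurable]:
  fixes f g :: "real \<Rightarrow> 'a::{real_normed_field, banach, second_countable_topology}"
  assumes [measurable]: "f \<in> borel_measurable borel" "g \<in> borel_measurable borel"
  shows "hartley_integrand f g x \<in> borel_measurable borel"
  unfolding hartley_integrand_def by measurable

text \<open>
  Each of the four terms of the kernel has the form \<open>g (s * x + t * y)\<close> with signs \<open>s\<close> and \<open>t\<close>, so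
  Young's inequality applies to each of them separately.
\<close>

lemma nn_integral_hartley_integrand_le:
  fixes f g :: "real \<Rightarrow> 'a::{real_normed_field, banach, second_countable_topology}"
    and h :: "real \<Rightarrow> 'b::{real_normed_field, banach, second_countable_topology}"
  assumes "p > 1" "q > 1" "r > 1" "1 / p + 1 / q + 1 / r = 2"
    and [measurable]: "f \<in> borel_measurable borel" "g \<in> borel_measurable borel"
      "h \<in> borel_measurable borel"
    and "f \<in> Lp_space p" "g \<in> Lp_space q" "h \<in> Lp_space r"
  shows "(\<integral>\<^sup>+x. \<integral>\<^sup>+y. ennreal (norm (hartley_integrand f g x y) * norm (h x)) \<partial>lborel \<partial>lborel)
    \<le> ennreal (4 * (Lp_norm p f * Lp_norm q g * Lp_norm r h))"
proof -
  define T where "T s t x y = ennreal (norm (f y) * norm (g (s * x + t * y)) * norm (h x))"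
    for s t x y
  have T: "(\<integral>\<^sup>+x. \<integral>\<^sup>+y. T s t x y \<partial>lborel \<partial>lborel)
      \<le> ennreal (Lp_norm p f * Lp_norm q g * Lp_norm r h)" if "\<bar>s\<bar> = 1" "\<bar>t\<bar> = 1" for s t
    unfolding T_def by (intro young_trilinear assms that)
  have [measurable]: "(\<lambda>(x, y). T s t x y) \<in> borel_measurable (borel \<Otimes>\<^sub>M borel)" for s t
    unfolding T_def by measurable
  have "(\<integral>\<^sup>+x. \<integral>\<^sup>+y. ennreal (norm (hartley_integrand f g x y) * norm (h x)) \<partial>lborel \<partial>lborel)
    \<le> (\<integral>\<^sup>+x. \<integral>\<^sup>+y. T 1 1 x y + T 1 (-1) x y + T (-1) 1 x y + T (-1) (-1) x y \<partial>lborel \<partial>lborel)"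
  proof (intro nn_integral_mono)
    fix x y
    have "norm (g (x + y) + g (x - y) + g (- x + y) - g (- x - y))
      \<le> norm (g (x + y)) + norm (g (x - y)) + norm (g (- x + y)) + norm (g (- x - y))"
      by (intro order_trans[OF norm_triangle_ineq4] add_mono order_trans[OF norm_triangle_ineq])
         auto
    then have "norm (hartley_integrand f g x y) * norm (h x)
      \<le> norm (f y) * (norm (g (x + y)) + norm (g (x - y)) + norm (g (- x + y))
          + norm (g (- x - y))) * norm (h x)"
      unfolding hartley_integrand_def norm_mult by (intro mult_mono) auto
    then show "ennreal (norm (hartley_integrand f g x y) * norm (h x))
      \<le> T 1 1 x y + T 1 (-1) x y + T (-1) 1 x y + T (-1) (-1) x y"
      by (simp add: T_def algebra_simps flip: ennreal_plus)
  qed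
  also have "\<dots> = (\<integral>\<^sup>+x. \<integral>\<^sup>+y. T 1 1 x y \<partial>lborel \<partial>lborel) + (\<integral>\<^sup>+x. \<integral>\<^sup>+y. T 1 (-1) x y \<partial>lborel \<partial>lborel)
      + (\<integral>\<^sup>+x. \<integral>\<^sup>+y. T (-1) 1 x y \<partial>lborel \<partial>lborel) + (\<integral>\<^sup>+x. \<integral>\<^sup>+y. T (-1) (-1) x y \<partial>lborel \<partial>lborel)"
    by (simp add: nn_integral_add)
  also have "\<dots> \<le> ennreal (Lp_norm p f * Lp_norm q g * Lp_norm r h)
      + ennreal (Lp_norm p f * Lp_norm q g * Lp_norm r h)
      + ennreal (Lp_norm p f * Lp_norm q g * Lp_norm r h)
      + ennreal (Lp_norm p f * Lp_norm q g * Lp_norm r h)"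
    by (intro add_mono T) auto
  also have "\<dots> = ennreal (4 * (Lp_norm p f * Lp_norm q g * Lp_norm r h))"
    by (simp add: Lp_norm_nonneg flip: ennreal_plus)
  finally show ?thesis .
qed

lemma indicator_interval_in_Lp_space:
  "(indicator {-n..n} :: real \<Rightarrow> real) \<in> Lp_space p"
proof -
  have "(\<lambda>x. norm (indicator {-n..n} x :: real) powr p) = indicator {-n..n}"
    by (auto simp: indicator_def fun_eq_iff)
  moreover have "integrable lebesgue (indicator {-n..n} :: real \<Rightarrow> real)"
    by (intro integrable_real_indicator) (auto simp: emeasure_lborel_Icc_eq)
  ultimately show ?thesis
    unfolding Lp_space_def by (simp add: borel_measurable_integrable)
qed

text \<open>
  Integrability of the kernel at almost every \<open>x\<close> cannot be read off from the estimate with a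
  given \<open>h\<close>, which says nothing where \<open>h\<close> vanishes. It follows from the estimates for the
  indicators of the intervals \<open>[-n, n]\<close>, which exhaust the line.
\<close>

lemma AE_integrable_hartley_integrand_borel:
  fixes f g :: "real \<Rightarrow> 'a::{real_normed_field, banach, second_countable_topology}"
  assumes "p > 1" "q > 1" "r > 1" "1 / p + 1 / q + 1 / r = 2"
    and [measurable]: "f \<in> borel_measurable borel" "g \<in> borel_measurable borel"
    and "f \<in> Lp_space p" "g \<in> Lp_space q"
  shows "AE x in lborel. integrable lborel (hartley_integrand f g x)"
proof -
  have "AE x in lborel. \<forall>n::nat. (\<integral>\<^sup>+y. ennreal (norm (hartley_integrand f g x y)
      * norm (indicator {- real n..real n} x :: real)) \<partial>lborel) \<noteq> \<infinity>"
    unfolding AE_all_countable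
  proof
    fix n :: nat
    let ?h = "indicator {- real n..real n} :: real \<Rightarrow> real"
    have "(\<integral>\<^sup>+x. \<integral>\<^sup>+y. ennreal (norm (hartley_integrand f g x y) * norm (?h x)) \<partial>lborel \<partial>lborel)
        \<le> ennreal (4 * (Lp_norm p f * Lp_norm q g * Lp_norm r ?h))"
      by (intro nn_integral_hartley_integrand_le assms indicator_interval_in_Lp_space) auto
    then show "AE x in lborel. (\<integral>\<^sup>+y. ennreal (norm (hartley_integrand f g x y)
      * norm (?h x)) \<partial>lborel) \<noteq> \<infinity>"
      by (intro nn_integral_PInf_AE) (auto simp: top_unique)
  qed
  then show ?thesis
  proof eventually_elim
    case (elim x)
    obtain n where n: "\<bar>x\<bar> \<le> real n"
      using real_arch_simple by blast
    then have "x \<in> {- real n..real n}"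
      by auto
    then have "(\<integral>\<^sup>+y. ennreal (norm (hartley_integrand f g x y)) \<partial>lborel) \<noteq> \<infinity>"
      using elim[rule_format, of n] by simp
    then show ?case
      by (intro integrableI_bounded) (auto simp: less_top)
  qed
qed

lemma hartley_conv_borel:
  fixes f g :: "real \<Rightarrow> 'a::{real_normed_field, banach, second_countable_topology}"
  assumes [measurable]: "f \<in> borel_measurable borel" "g \<in> borel_measurable borel"
  shows "hartley_conv f g x
    = (1 / (2 * sqrt (2 * pi))) *\<^sub>R (\<integral>y. hartley_integrand f g x y \<partial>lborel)"
  unfolding hartley_conv_def by (subst integral_completion) simp_all

lemma hartley_conv_measurable [measurable]:
  fixes f g :: "real \<Rightarrow> 'a::{real_normed_field, banach, second_countable_topology}"
  assumes [measurable]: "f \<in> borel_measurable borel" "g \<in> borel_measurable borel"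
  shows "hartley_conv f g \<in> borel_measurable borel"
proof -
  have "(\<lambda>x. (1 / (2 * sqrt (2 * pi))) *\<^sub>R (\<integral>y. hartley_integrand f g x y \<partial>lborel))
      \<in> borel_measurable borel"
    by measurable
  then show ?thesis
    by (simp add: hartley_conv_borel[OF assms, abs_def] cong: measurable_cong)
qed

lemma nn_integral_hartley_conv_le:
  fixes f g h :: "real \<Rightarrow> 'a::{real_normed_field, banach, second_countable_topology}"
  assumes "p > 1" "q > 1" "r > 1" "1 / p + 1 / q + 1 / r = 2"
    and [measurable]: "f \<in> borel_measurable borel" "g \<in> borel_measurable borel"
      "h \<in> borel_measurable borel"
    and "f \<in> Lp_space p" "g \<in> Lp_space q" "h \<in> Lp_space r"
  shows "(\<integral>\<^sup>+x. ennreal (norm (hartley_conv f g x * h x)) \<partial>lborel)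
    \<le> ennreal (sqrt (2 / pi) * Lp_norm p f * Lp_norm q g * Lp_norm r h)"
proof -
  define k where "k = 1 / (2 * sqrt (2 * pi))"
  have k: "k \<ge> 0"
    by (simp add: k_def)
  have "(\<integral>\<^sup>+x. ennreal (norm (hartley_conv f g x * h x)) \<partial>lborel)
    \<le> (\<integral>\<^sup>+x. ennreal k * (\<integral>\<^sup>+y. ennreal (norm (hartley_integrand f g x y) * norm (h x)) \<partial>lborel) \<partial>lborel)"
  proof (intro nn_integral_mono)
    fix x
    have "ennreal (norm (hartley_conv f g x * h x))
        = ennreal k * ennreal (norm (h x)) * ennreal (norm (\<integral>y. hartley_integrand f g x y \<partial>lborel))"
      using k by (simp add: hartley_conv_borel norm_mult k_def mult_ac flip: ennreal_mult)
    also have "\<dots> \<le> ennreal k * ennreal (norm (h x)) * (\<integral>\<^sup>+y. norm (hartley_integrand f g x y) \<partial>lborel)"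
    proof (intro mult_left_mono)
      show "ennreal (norm (\<integral>y. hartley_integrand f g x y \<partial>lborel))
          \<le> (\<integral>\<^sup>+y. norm (hartley_integrand f g x y) \<partial>lborel)"
        by (cases "integrable lborel (hartley_integrand f g x)")
          (simp_all add: integral_norm_bound_ennreal not_integrable_integral_eq)
    qed simp
    also have "\<dots> = ennreal k * (\<integral>\<^sup>+y. ennreal (norm (hartley_integrand f g x y) * norm (h x)) \<partial>lborel)"
      by (simp add: ennreal_mult nn_integral_cmult mult_ac)
    finally show "ennreal (norm (hartley_conv f g x * h x))
        \<le> ennreal k * (\<integral>\<^sup>+y. ennreal (norm (hartley_integrand f g x y) * norm (h x)) \<partial>lborel)" .
  qed
  also have "\<dots> = ennreal k * (\<integral>\<^sup>+x. \<integral>\<^sup>+y. ennreal (norm (hartley_integrand f g x y) * norm (h x)) \<partial>lborel \<partial>lborel)"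
    by (rule nn_integral_cmult) measurable
  also have "\<dots> \<le> ennreal k * ennreal (4 * (Lp_norm p f * Lp_norm q g * Lp_norm r h))"
    by (intro mult_left_mono nn_integral_hartley_integrand_le assms) auto
  also have "\<dots> = ennreal (k * (4 * (Lp_norm p f * Lp_norm q g * Lp_norm r h)))"
    using k by (simp add: Lp_norm_nonneg ennreal_mult)
  also have "k * (4 * (Lp_norm p f * Lp_norm q g * Lp_norm r h))
      = sqrt (2 / pi) * Lp_norm p f * Lp_norm q g * Lp_norm r h"
  proof -
    have "4 * k = sqrt (2 / pi)"
      by (simp add: k_def real_sqrt_mult real_sqrt_divide real_div_sqrt field_simps)
    then show ?thesis
      by (simp add: mult_ac)
  qed
  finally show ?thesis .
qed

section \<open>Passage to Lebesgue measurable functions\<close>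

lemma Lp_space_cong_AE:
  assumes "f \<in> Lp_space p" and "f' \<in> borel_measurable borel" and eq: "AE x in lborel. f x = f' x"
  shows "f' \<in> Lp_space p" and "Lp_norm p f' = Lp_norm p f"
proof -
  have [measurable]: "f \<in> borel_measurable lebesgue" "f' \<in> borel_measurable lebesgue"
    using assms by (auto simp: Lp_space_def intro!: measurable_completion)
  have ae: "AE x in lebesgue. norm (f' x) powr p = norm (f x) powr p"
    using AE_completion[OF eq] by eventually_elim simp
  show "f' \<in> Lp_space p"
    using assms(1) integrable_cong_AE[OF _ _ ae] by (auto simp: Lp_space_def)
  show "Lp_norm p f' = Lp_norm p f"
    unfolding Lp_norm_def using integral_cong_AE[OF _ _ ae] by simp
qed

text \<open>
  This holds for every \<open>x\<close>, not only for almost every \<open>x\<close>: for fixed \<open>x\<close> the four arguments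
  of \<open>g\<close> are invertible affine functions of \<open>y\<close>.
\<close>

lemma AE_hartley_integrand_cong:
  assumes f: "AE x in lborel. f x = f' x" and g: "AE x in lborel. g x = g' x"
  shows "AE y in lebesgue. hartley_integrand f g x y = hartley_integrand f' g' x y"
proof (rule AE_completion)
  have "AE y in lborel. g (x + 1 * y) = g' (x + 1 * y)" "AE y in lborel. g (x + (-1) * y) = g' (x + (-1) * y)"
    "AE y in lborel. g (- x + 1 * y) = g' (- x + 1 * y)" "AE y in lborel. g (- x + (-1) * y) = g' (- x + (-1) * y)"
    by (rule AE_lborel_affine[OF _ g]; simp)+
  then show "AE y in lborel. hartley_integrand f g x y = hartley_integrand f' g' x y"
    using f by eventually_elim (simp add: hartley_integrand_def)
qed

lemma hartley_integrand_measurable_lebesgue: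
  fixes f g :: "real \<Rightarrow> 'a::{real_normed_field, banach, second_countable_topology}"
  assumes "f \<in> borel_measurable lebesgue" "g \<in> borel_measurable lebesgue"
  shows "hartley_integrand f g x \<in> borel_measurable lebesgue"
proof -
  have [measurable]: "(\<lambda>y. g (x + y)) \<in> borel_measurable lebesgue"
      "(\<lambda>y. g (x - y)) \<in> borel_measurable lebesgue"
      "(\<lambda>y. g (- x + y)) \<in> borel_measurable lebesgue"
      "(\<lambda>y. g (- x - y)) \<in> borel_measurable lebesgue"
    using borel_measurable_lebesgue_affine[OF assms(2), of 1 x]
      borel_measurable_lebesgue_affine[OF assms(2), of "-1" x]
      borel_measurable_lebesgue_affine[OF assms(2), of 1 "- x"]
      borel_measurable_lebesgue_affine[OF assms(2), of "-1" "- x"] by simp_all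
  note [measurable] = assms(1)
  show ?thesis
    unfolding hartley_integrand_def by measurable
qed

theorem theorem3p4:
  fixes p q r :: real
    and f g h :: "real \<Rightarrow> 'a::{real_normed_field, banach, second_countable_topology}"
  assumes "p > 1" and "q > 1" and "r > 1"
    and "1 / p + 1 / q + 1 / r = 2"
    and "f \<in> Lp_space p" and "g \<in> Lp_space q" and "h \<in> Lp_space r"
  shows "(AE x in lebesgue. integrable lebesgue (hartley_integrand f g x)) \<and>
    integrable lebesgue (\<lambda>x. hartley_conv f g x * h x) \<and>
    norm (LINT x|lebesgue. hartley_conv f g x * h x)
      \<le> sqrt (2 / pi) * Lp_norm p f * Lp_norm q g * Lp_norm r h"
proof -
  have meas: "f \<in> borel_measurable lebesgue" "g \<in> borel_measurable lebesgue"
      "h \<in> borel_measurable lebesgue"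
    using assms by (auto simp: Lp_space_def)
  obtain f' where f'_b: "f' \<in> borel_measurable borel" and f': "AE x in lborel. f x = f' x"
    using completion_ex_borel_measurable_banach[OF meas(1)] by auto
  obtain g' where g'_b: "g' \<in> borel_measurable borel" and g': "AE x in lborel. g x = g' x"
    using completion_ex_borel_measurable_banach[OF meas(2)] by auto
  obtain h' where h'_b: "h' \<in> borel_measurable borel" and h': "AE x in lborel. h x = h' x"
    using completion_ex_borel_measurable_banach[OF meas(3)] by auto
  note [measurable] = f'_b g'_b h'_b
  note Lp = Lp_space_cong_AE[OF assms(5) f'_b f'] Lp_space_cong_AE[OF assms(6) g'_b g']
    Lp_space_cong_AE[OF assms(7) h'_b h']
  have meas': "f' \<in> borel_measurable lebesgue" "g' \<in> borel_measurable lebesgue"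
    by (auto intro!: measurable_completion)
  have int_iff: "integrable lebesgue (hartley_integrand f g x)
      \<longleftrightarrow> integrable lebesgue (hartley_integrand f' g' x)" for x
    by (intro integrable_cong_AE hartley_integrand_measurable_lebesgue meas meas'
        AE_hartley_integrand_cong f' g')
  have conv_eq: "hartley_conv f g = hartley_conv f' g'"
  proof
    fix x
    have "(LINT y|lebesgue. hartley_integrand f g x y)
        = (LINT y|lebesgue. hartley_integrand f' g' x y)"
      by (intro integral_cong_AE hartley_integrand_measurable_lebesgue meas meas'
          AE_hartley_integrand_cong f' g')
    then show "hartley_conv f g x = hartley_conv f' g' x"
      by (simp add: hartley_conv_def)
  qed
  have ae: "AE x in lebesgue. integrable lebesgue (hartley_integrand f g x)"
  proof -
    have "AE x in lborel. integrable lborel (hartley_integrand f' g' x)"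
      by (rule AE_integrable_hartley_integrand_borel[OF assms(1-4)]) (use Lp in auto)
    then have "AE x in lebesgue. integrable lborel (hartley_integrand f' g' x)"
      by (rule AE_completion)
    then show ?thesis
      by (simp add: int_iff integrable_completion)
  qed
  let ?N = "sqrt (2 / pi) * Lp_norm p f * Lp_norm q g * Lp_norm r h"
  let ?u = "\<lambda>x. hartley_conv f g x * h x" and ?u' = "\<lambda>x. hartley_conv f' g' x * h' x"
  have bound: "(\<integral>\<^sup>+x. ennreal (norm (?u' x)) \<partial>lborel) \<le> ennreal ?N"
    using nn_integral_hartley_conv_le[OF assms(1-4) f'_b g'_b h'_b] Lp by simp
  have "hartley_conv f' g' \<in> borel_measurable lebesgue" "h' \<in> borel_measurable lebesgue"
    by (auto intro!: measurable_completion)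
  note [measurable] = this meas(3)
  have eq: "AE x in lebesgue. ?u x = ?u' x"
    using AE_completion[OF h'] by eventually_elim (simp add: conv_eq)
  have u_meas: "?u \<in> borel_measurable lebesgue" "?u' \<in> borel_measurable lebesgue"
    unfolding conv_eq by measurable
  have "integrable lborel ?u'"
    using bound by (intro integrableI_bounded) (auto simp: le_less_trans)
  then have int: "integrable lebesgue ?u"
    using integrable_cong_AE[OF u_meas eq] by (simp add: integrable_completion)
  have "(LINT x|lebesgue. ?u x) = (\<integral>x. ?u' x \<partial>lborel)"
    using integral_cong_AE[OF u_meas eq] by (simp add: integral_completion)
  moreover have "ennreal (norm (\<integral>x. ?u' x \<partial>lborel)) \<le> ennreal ?N"
    using integral_norm_bound_ennreal[OF \<open>integrable lborel ?u'\<close>] bound by (rule order_trans)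
  ultimately have "norm (LINT x|lebesgue. ?u x) \<le> ?N"
    by (simp add: Lp_norm_nonneg ennreal_le_iff)
  with ae int show ?thesis
    by blast
qed

end
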